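(* Let $G=(V,E,w)$ be a connected undirected weighted graph with weights $w_{ij}=w_{ji}>0$, let $k\ge1$, let the functions $h_{ij}$ satisfy the standing assumptions below, and let $b\in\mathbb{R}^V$ with $\sum_i b_i=0$. If $g$ is b-feasible and $g$ minimizes $\Phi$ over all cycle updates in $G$ (that is, $\Phi(g)\le\Phi(g+\alpha(C,t))$ for every oriented cycle $C$ of $G$ and every $t\in\mathbb{R}$), then $g$ is also p-feasible.
   Context: Standing assumptions: for each edge $(i,j)\in E$ there is a function $h_{ij}=h_{ji}:\mathbb{R}\to\mathbb{R}$ which is continuous and odd, whose derivative $h_{ij}'$ exists, is left-continuous and satisfies $1/k\le h_{ij}'(v)<k$, and such that $v\mapsto v\,h_{ij}'(v)$ is strictly increasing. Edge vectors have one real variable per edge, with the convention $g_{ji}=-g_{ij}$. $N(i)$ denotes the set of neighbours of $i$. $g$ is b-feasible if $\sum_{j\in N(i)}w_{ij}h_{ij}(g_{ij})=b_i$ for all $i\in V$; $g$ is p-feasible if there is $x\in\mathbb{R}^V$ with $g_{ij}=x_i-x_j$ for all $(i,j)\in E$. Energy: $\Phi(g)=\sum_{(i,j)\in E}\phi_{ij}(g_{ij})$, $\phi_{ij}(u)=w_{ij}\int_0^u s\,h_{ij}'(s)\,ds$. For an oriented cycle $C$ and $t\in\mathbb{R}$, $\alpha(C,t)$ is the edge vector vanishing off $C$ with $w_{ij}h_{ij}(g_{ij}+\alpha_{ij}(C,t))=w_{ij}h_{ij}(g_{ij})+t$ for $(i,j)\in C$; a cycle update replaces $g$ by $g+\alpha(C,t)$.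 *)

theory Defs
  imports "HOL-Analysis.Analysis" "Graph_Theory.Pair_Digraph" "Graph_Theory.Digraph_Component"
begin

text \<open>
  A finite simple undirected graph is a \<^locale>\<open>pair_graph\<close>: its arc set is symmetric and
  irreflexive, so the undirected edge between i and j appears as the two arcs (i,j) and (j,i).
  Edge data such as w and h are curried functions of the two end points; only their values
  on arcs matter.
\<close>

definition neighbours :: "'v pair_pre_digraph \<Rightarrow> 'v \<Rightarrow> 'v set" where
  "neighbours G i = {j. (i, j) \<in> parcs G}"

definition edge_weights :: "'v pair_pre_digraph \<Rightarrow> ('v \<Rightarrow> 'v \<Rightarrow> real) \<Rightarrow> bool" where
  "edge_weights G w \<longleftrightarrow> (\<forall>(i, j) \<in> parcs G. w i j = w j i \<and> w i j > 0)"

definition admissible_fun :: "real \<Rightarrow> (real \<Rightarrow> real) \<Rightarrow> bool" where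
  "admissible_fun k f \<longleftrightarrow>
     continuous_on UNIV f \<and>
     (\<forall>v. f (- v) = - f v) \<and>
     (\<forall>v. f field_differentiable at v) \<and>
     (\<forall>v. continuous (at_left v) (deriv f)) \<and>
     (\<forall>v. 1 / k \<le> deriv f v \<and> deriv f v < k) \<and>
     strict_mono (\<lambda>v. v * deriv f v)"

definition edge_funs :: "'v pair_pre_digraph \<Rightarrow> real \<Rightarrow> ('v \<Rightarrow> 'v \<Rightarrow> real \<Rightarrow> real) \<Rightarrow> bool" where
  "edge_funs G k h \<longleftrightarrow> (\<forall>(i, j) \<in> parcs G. h i j = h j i \<and> admissible_fun k (h i j))"

definition edge_vector :: "'v pair_pre_digraph \<Rightarrow> ('v \<Rightarrow> 'v \<Rightarrow> real) \<Rightarrow> bool" where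
  "edge_vector G g \<longleftrightarrow> (\<forall>(i, j) \<in> parcs G. g j i = - g i j)"

definition b_feasible ::
  "'v pair_pre_digraph \<Rightarrow> ('v \<Rightarrow> 'v \<Rightarrow> real) \<Rightarrow> ('v \<Rightarrow> 'v \<Rightarrow> real \<Rightarrow> real) \<Rightarrow> ('v \<Rightarrow> real)
     \<Rightarrow> ('v \<Rightarrow> 'v \<Rightarrow> real) \<Rightarrow> bool" where
  "b_feasible G w h b g \<longleftrightarrow>
     (\<forall>i \<in> pverts G. (\<Sum>j \<in> neighbours G i. w i j * h i j (g i j)) = b i)"

definition p_feasible :: "'v pair_pre_digraph \<Rightarrow> ('v \<Rightarrow> 'v \<Rightarrow> real) \<Rightarrow> bool" where
  "p_feasible G g \<longleftrightarrow> (\<exists>x :: 'v \<Rightarrow> real. \<forall>(i, j) \<in> parcs G. g i j = x i - x j)"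

definition edge_energy ::
  "('v \<Rightarrow> 'v \<Rightarrow> real) \<Rightarrow> ('v \<Rightarrow> 'v \<Rightarrow> real \<Rightarrow> real) \<Rightarrow> 'v \<Rightarrow> 'v \<Rightarrow> real \<Rightarrow> real" where
  "edge_energy w h i j u = w i j * (LBINT s=ereal 0..ereal u. s * deriv (h i j) s)"

text \<open>
  The energy has one summand per undirected edge; since (i,j) and (j,i) contribute equally,
  this is half the sum over all arcs (see the lemma \<open>energy_orientation\<close> below).
\<close>
definition energy ::
  "'v pair_pre_digraph \<Rightarrow> ('v \<Rightarrow> 'v \<Rightarrow> real) \<Rightarrow> ('v \<Rightarrow> 'v \<Rightarrow> real \<Rightarrow> real)
     \<Rightarrow> ('v \<Rightarrow> 'v \<Rightarrow> real) \<Rightarrow> real" where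
  "energy G w h g = (1 / 2) * (\<Sum>(i, j) \<in> parcs G. edge_energy w h i j (g i j))"

text \<open>
  The library's cycles in a symmetric digraph include the walk along an arc and back, which is
  not a cycle of the undirected graph; the length bound excludes exactly these.
\<close>
definition oriented_cycle :: "'v pair_pre_digraph \<Rightarrow> ('v \<times> 'v) list \<Rightarrow> bool" where
  "oriented_cycle G C \<longleftrightarrow> pre_digraph.cycle (with_proj G) C \<and> 3 \<le> length C"

definition is_cycle_shift ::
  "'v pair_pre_digraph \<Rightarrow> ('v \<Rightarrow> 'v \<Rightarrow> real) \<Rightarrow> ('v \<Rightarrow> 'v \<Rightarrow> real \<Rightarrow> real) \<Rightarrow> ('v \<Rightarrow> 'v \<Rightarrow> real)
     \<Rightarrow> ('v \<times> 'v) list \<Rightarrow> real \<Rightarrow> ('v \<Rightarrow> 'v \<Rightarrow> real) \<Rightarrow> bool" where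
  "is_cycle_shift G w h g C t a \<longleftrightarrow>
     edge_vector G a \<and>
     (\<forall>i j. (i, j) \<notin> set C \<and> (j, i) \<notin> set C \<longrightarrow> a i j = 0) \<and>
     (\<forall>(i, j) \<in> set C. w i j * h i j (g i j + a i j) = w i j * h i j (g i j) + t)"

text \<open>Existence and uniqueness are shown in \<open>ex1_cycle_shift\<close> below.\<close>
definition cycle_shift ::
  "'v pair_pre_digraph \<Rightarrow> ('v \<Rightarrow> 'v \<Rightarrow> real) \<Rightarrow> ('v \<Rightarrow> 'v \<Rightarrow> real \<Rightarrow> real) \<Rightarrow> ('v \<Rightarrow> 'v \<Rightarrow> real)
     \<Rightarrow> ('v \<times> 'v) list \<Rightarrow> real \<Rightarrow> ('v \<Rightarrow> 'v \<Rightarrow> real)" where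
  "cycle_shift G w h g C t = (THE a. is_cycle_shift G w h g C t a)"

definition cycle_update ::
  "'v pair_pre_digraph \<Rightarrow> ('v \<Rightarrow> 'v \<Rightarrow> real) \<Rightarrow> ('v \<Rightarrow> 'v \<Rightarrow> real \<Rightarrow> real) \<Rightarrow> ('v \<Rightarrow> 'v \<Rightarrow> real)
     \<Rightarrow> ('v \<times> 'v) list \<Rightarrow> real \<Rightarrow> ('v \<Rightarrow> 'v \<Rightarrow> real)" where
  "cycle_update G w h g C t = (\<lambda>i j. g i j + cycle_shift G w h g C t i j)"


lemma admissible_deriv:
  assumes "admissible_fun k f"
  shows "(f has_real_derivative deriv f v) (at v)"
  using assms unfolding admissible_fun_def by (simp add: DERIV_deriv_iff_field_differentiable)

lemma admissible_deriv_even: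
  assumes "admissible_fun k f"
  shows "deriv f (- v) = deriv f v"
proof -
  have "((\<lambda>x. f (- x)) has_real_derivative deriv f (- v) * (- 1)) (at v)"
    by (rule DERIV_chain2[OF admissible_deriv[OF assms]]) (auto intro!: derivative_eq_intros)
  moreover have "(\<lambda>x. f (- x)) = (\<lambda>x. - f x)"
    using assms unfolding admissible_fun_def by auto
  moreover have "((\<lambda>x. - f x) has_real_derivative - deriv f v) (at v)"
    by (rule DERIV_minus[OF admissible_deriv[OF assms]])
  ultimately show ?thesis
    using DERIV_unique by fastforce
qed

lemma edge_energy_even:
  assumes "admissible_fun k (h i j)"
  shows "edge_energy w h i j (- u) = edge_energy w h i j u"
proof -
  have "(LBINT s=ereal 0..ereal (- u). s * deriv (h i j) s)
      = (LBINT s=ereal u..ereal 0. (- s) * deriv (h i j) (- s))"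
    by (subst interval_integral_reflect) simp
  also have "\<dots> = - (LBINT s=ereal u..ereal 0. s * deriv (h i j) s)"
    by (simp add: admissible_deriv_even[OF assms] flip: interval_lebesgue_integral_uminus)
  also have "\<dots> = (LBINT s=ereal 0..ereal u. s * deriv (h i j) s)"
    by (subst interval_integral_endpoints_reverse) simp
  finally show ?thesis by (simp add: edge_energy_def)
qed

lemma energy_orientation:
  assumes "pair_graph G" "edge_weights G w" "edge_funs G k h" "edge_vector G g"
    and "parcs G = D \<union> D\<inverse>" "D \<inter> D\<inverse> = {}"
  shows "energy G w h g = (\<Sum>(i, j) \<in> D. edge_energy w h i j (g i j))"
proof -
  interpret pair_graph G by fact
  let ?f = "\<lambda>(i, j). edge_energy w h i j (g i j)"
  have fin: "finite D" "finite (D\<inverse>)"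
    using pair_finite_arcs assms(5) by auto
  have "sum ?f (D\<inverse>) = sum ?f D"
  proof (rule sum.reindex_bij_witness[of _ prod.swap prod.swap])
    fix e assume e: "e \<in> D\<inverse>"
    obtain i j where ij: "e = (i, j)" by (cases e)
    with e assms(5) have arcs: "(j, i) \<in> parcs G" by auto
    then have "g i j = - g j i" "w j i = w i j" "h j i = h i j" "admissible_fun k (h j i)"
      using assms unfolding edge_vector_def edge_weights_def edge_funs_def by blast+
    then show "?f (prod.swap e) = ?f e"
      using edge_energy_even[of k h j i w "g j i"] by (auto simp: ij edge_energy_def)
  qed auto
  then show ?thesis
    unfolding energy_def assms(5) using fin assms(6) by (simp add: sum.union_disjoint)
qed

lemma admissible_fun_bij:
  assumes "admissible_fun k f" "1 \<le> k"
  shows "strict_mono f" "\<exists>x. f x = y"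
proof -
  have lower: "1 / k \<le> deriv f v" for v
    using assms unfolding admissible_fun_def by auto
  have pos: "0 < 1 / k" and k0: "k \<noteq> 0" using assms(2) by auto
  show "strict_mono f"
  proof (rule strict_monoI)
    fix a b :: real assume "a < b"
    have "0 < deriv f v" for v using lower[of v] pos by linarith
    then show "f a < f b"
      using DERIV_pos_imp_increasing[OF \<open>a < b\<close>, of f] admissible_deriv[OF assms(1)] by blast
  qed
  have odd: "f (- v) = - f v" for v
    using assms unfolding admissible_fun_def by blast
  have f0: "f 0 = 0"
    using odd[of 0] by simp
  define M where "M = k * \<bar>y\<bar>"
  have M: "0 \<le> M" using assms by (simp add: M_def)
  have "f 0 - 0 / k \<le> f M - M / k"
    by (rule DERIV_nonneg_imp_nondecreasing[OF M])
      (auto intro!: exI derivative_eq_intros admissible_deriv[OF assms(1)] simp: lower k0)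
  then have up: "\<bar>y\<bar> \<le> f M" using assms by (simp add: f0 M_def)
  with odd[of M] have "f (- M) \<le> y" "y \<le> f M" by auto
  moreover have "continuous_on {- M..M} f"
    using assms(1) unfolding admissible_fun_def by (blast intro: continuous_on_subset)
  ultimately show "\<exists>x. f x = y"
    using IVT'[of f "- M" y M] M by auto
qed

lemma pcas_nth:
  assumes "pcas u C v" "Suc n < length C"
  shows "fst (C ! Suc n) = snd (C ! n)"
  using assms
proof (induction C arbitrary: u n)
  case (Cons e C)
  then show ?case by (cases n; cases C) auto
qed simp

lemma pcas_last: "pcas u C v \<Longrightarrow> C \<noteq> [] \<Longrightarrow> snd (last C) = v"
  by (induction C arbitrary: u) auto

lemma pawalk_verts_tl: "pcas u C v \<Longrightarrow> tl (pawalk_verts u C) = map snd C"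
proof (induction C arbitrary: u)
  case (Cons e C)
  then show ?case by (cases C) auto
qed simp

lemma oriented_cycle_no_reverse:
  assumes "oriented_cycle G C" "(i, j) \<in> set C"
  shows "(j, i) \<notin> set C"
proof
  assume ji: "(j, i) \<in> set C"
  let ?L = "length C"
  obtain u where u: "pcas u C u" "distinct (map snd C)" and L: "3 \<le> ?L"
    using assms(1) unfolding oriented_cycle_def pre_digraph.cycle_def pre_digraph.awalk_def
    by (auto simp: cas_with_proj_eq awalk_verts_with_proj_eq pawalk_verts_tl)
  from assms(2) ji obtain m n where mn: "m < ?L" "n < ?L" "C ! m = (i, j)" "C ! n = (j, i)"
    by (auto simp: in_set_conv_nth)
  have prev: "snd (C ! (if l = 0 then ?L - 1 else l - 1)) = fst (C ! l)" if "l < ?L" for l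
  proof (cases l)
    case 0
    have "C \<noteq> []" using L by auto
    then have "snd (C ! (?L - 1)) = u" "fst (C ! 0) = u"
      using pcas_last[OF u(1)] u(1) by (simp add: last_conv_nth, cases C, auto)
    with 0 show ?thesis by simp
  next
    case (Suc p)
    then show ?thesis using pcas_nth[OF u(1), of p] that by simp
  qed
  have inj: "p = q" if "p < ?L" "q < ?L" "snd (C ! p) = snd (C ! q)" for p q
    using u(2) that by (metis length_map nth_eq_iff_index_eq nth_map)
  have "(if m = 0 then ?L - 1 else m - 1) = n"
    by (rule inj) (use prev[OF mn(1)] mn L in \<open>auto simp del: One_nat_def\<close>)
  moreover have "(if n = 0 then ?L - 1 else n - 1) = m"
    by (rule inj) (use prev[OF mn(2)] mn L in \<open>auto simp del: One_nat_def\<close>)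
  ultimately show False using L by (auto split: if_splits)
qed

lemma ex1_cycle_shift:
  assumes "edge_weights G w" "edge_funs G k h" "1 \<le> k" "oriented_cycle G C"
  shows "\<exists>!a. is_cycle_shift G w h g C t a"
proof -
  have sub: "set C \<subseteq> parcs G"
    using assms(4) unfolding oriented_cycle_def pre_digraph.cycle_def pre_digraph.awalk_def by auto
  have adm: "admissible_fun k (h i j)" and wpos: "w i j > 0" if "(i, j) \<in> set C" for i j
    using that sub assms unfolding edge_funs_def edge_weights_def by blast+
  define P where "P i j x \<longleftrightarrow> w i j * h i j (g i j + x) = w i j * h i j (g i j) + t" for i j x
  have ex: "\<exists>x. P i j x" if ij: "(i, j) \<in> set C" for i j
  proof -
    obtain y where "h i j y = h i j (g i j) + t / w i j"
      using admissible_fun_bij(2)[OF adm[OF ij] assms(3)] by blast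
    then have "P i j (y - g i j)"
      using wpos[OF ij] by (simp add: P_def distrib_left)
    then show ?thesis ..
  qed
  have unique: "x = y" if "(i, j) \<in> set C" "P i j x" "P i j y" for i j x y
  proof -
    have "w i j * h i j (g i j + x) = w i j * h i j (g i j + y)"
      using that by (simp add: P_def)
    then have "h i j (g i j + x) = h i j (g i j + y)"
      using wpos[OF that(1)] by simp
    then show ?thesis
      using strict_mono_eq[OF admissible_fun_bij(1)[OF adm[OF that(1)] assms(3)]] by simp
  qed
  define s where "s i j = (SOME x. P i j x)" for i j
  have s: "P i j (s i j)" if "(i, j) \<in> set C" for i j
    unfolding s_def using ex[OF that] by (rule someI_ex)
  define a where "a i j = (if (i, j) \<in> set C then s i j else if (j, i) \<in> set C then - s j i else 0)"
    for i j
  have "is_cycle_shift G w h g C t a"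
    unfolding is_cycle_shift_def edge_vector_def
    using oriented_cycle_no_reverse[OF assms(4)] s by (auto simp: a_def P_def)
  moreover have "a' = a" if "is_cycle_shift G w h g C t a'" "is_cycle_shift G w h g C t a" for a' a
  proof (intro ext)
    fix i j
    have on: "a' i j = a i j" if "(i, j) \<in> set C" for i j
      using that \<open>is_cycle_shift G w h g C t a'\<close> \<open>is_cycle_shift G w h g C t a\<close>
      by (intro unique[OF that]) (auto simp: is_cycle_shift_def P_def)
    have neg: "a' i j = - a' j i" "a i j = - a j i" if "(j, i) \<in> set C"
      using that sub \<open>is_cycle_shift G w h g C t a'\<close> \<open>is_cycle_shift G w h g C t a\<close>
      unfolding is_cycle_shift_def edge_vector_def by blast+
    show "a' i j = a i j"
    proof (cases "(i, j) \<in> set C \<or> (j, i) \<in> set C")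
      case True
      then show ?thesis using on neg by auto
    next
      case False
      then show ?thesis using that unfolding is_cycle_shift_def by auto
    qed
  qed
  ultimately show ?thesis by (intro ex1I[of _ a]) auto
qed

end

theory Submission
  imports Defs
begin

text \<open>
  Along an oriented cycle C the shift satisfies d\<alpha>/dt = 1 / (w h'(g + \<alpha>)), while the edge energy has
  derivative w u h'(u) at u. Hence t \<mapsto> \<Phi>(g + \<alpha>(C, t)) has derivative \<Sum>g over C at t = 0, and
  minimality makes this sum vanish. As g is antisymmetric, it then sums to zero along every closed
  walk, so summing g along a walk to a fixed root defines a potential.
\<close>

text \<open>
  Integration by parts: u f(u) minus an antiderivative of f is an antiderivative of u f'(u), so
  continuity of f' is not needed.
\<close>
lemma admissible_integral:
  assumes "admissible_fun k f"
  shows "\<exists>F. (\<forall>u. (F has_real_derivative u * deriv f u) (at u)) \<and>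
             (\<forall>u. (LBINT s=ereal 0..ereal u. s * deriv f s) = F u - F 0)"
proof -
  let ?f' = "\<lambda>s. s * deriv f s"
  have cont: "isCont f v" for v
    using admissible_deriv[OF assms] by (rule DERIV_isCont)
  obtain H where H: "(H has_real_derivative f v) (at v)" for v
    using einterval_antiderivative[of "-\<infinity>" "\<infinity>" f] cont
    by (auto simp: has_real_derivative_iff_has_vector_derivative)
  define F where "F u = u * f u - H u" for u
  have F: "(F has_real_derivative ?f' u) (at u)" for u
    unfolding F_def by (auto intro!: derivative_eq_intros admissible_deriv[OF assms] H)
  \<comment> \<open>Monotonicity stands in for continuity: it makes \<open>?f'\<close> Borel
    measurable and bounds it on {a..b} by its end values, hence integrable there.\<close>
  have mono: "mono ?f'"
    using assms unfolding admissible_fun_def by (blast intro: strict_mono_mono)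
  have ftc: "(LBINT s=ereal a..ereal b. ?f' s) = F b - F a" if "a \<le> b" for a b :: real
  proof -
    have "AE s in lborel. s \<in> {a..b} \<longrightarrow> norm (?f' s) \<le> \<bar>?f' a\<bar> + \<bar>?f' b\<bar>"
    proof (intro AE_I2 impI)
      fix s assume "s \<in> {a..b}"
      then have "?f' a \<le> ?f' s" "?f' s \<le> ?f' b"
        using monoD[OF mono] by auto
      then show "norm (?f' s) \<le> \<bar>?f' a\<bar> + \<bar>?f' b\<bar>" by auto
    qed
    then have "set_integrable lborel {a..b} ?f'"
      unfolding set_integrable_def using that borel_measurable_mono[OF mono]
      by (intro integrableI_bounded_set_indicator) auto
    \<comment> \<open>The gauge integral needs only a pointwise derivative; integrability then
      identifies it with the Lebesgue integral.\<close>
    moreover have "(?f' has_integral F b - F a) {a..b}"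
      using F that by (intro fundamental_theorem_of_calculus)
        (auto simp: has_real_derivative_iff_has_vector_derivative[symmetric]
              intro: has_field_derivative_at_within)
    ultimately show ?thesis
      using interval_integral_eq_integral[of a b ?f'] that by (simp add: integral_unique)
  qed
  have "(LBINT s=ereal 0..ereal u. ?f' s) = F u - F 0" for u
  proof (cases "0 \<le> u")
    case False
    then show ?thesis
      using ftc[of u 0] by (subst interval_integral_endpoints_reverse) simp
  qed (rule ftc)
  with F show ?thesis by blast
qed

lemma DERIV_edge_energy:
  assumes "admissible_fun k (h i j)"
  shows "(edge_energy w h i j has_real_derivative w i j * (u * deriv (h i j) u)) (at u)"
proof -
  obtain F where F: "\<And>u. (F has_real_derivative u * deriv (h i j) u) (at u)"
    and int: "\<And>u. (LBINT s=ereal 0..ereal u. s * deriv (h i j) s) = F u - F 0"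
    using admissible_integral[OF assms] by blast
  have "edge_energy w h i j = (\<lambda>u. w i j * (F u - F 0))"
    by (rule ext) (simp only: edge_energy_def int)
  then show ?thesis
    by (auto intro!: derivative_eq_intros F)
qed

text \<open>Inverse function theorem: \<gamma> inverts v \<mapsto> c f(v) - c f(x), which is
  strictly increasing with positive derivative. It is applied with c = w and x = g on an arc of the
  cycle, where \<gamma>(t) is the updated value.\<close>

lemma admissible_shift:
  assumes "admissible_fun k f" "1 \<le> k" "0 < c" and \<gamma>: "\<And>t. c * f (\<gamma> t) = c * f x + t"
  shows "\<gamma> 0 = x" "(\<gamma> has_real_derivative inverse (c * deriv f x)) (at 0)"
proof -
  let ?F = "\<lambda>v. c * f v - c * f x"
  have F\<gamma>: "?F (\<gamma> t) = t" for t using \<gamma>[of t] by simp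
  have inj: "f u = f v \<longleftrightarrow> u = v" for u v
    using strict_mono_eq[OF admissible_fun_bij(1)[OF assms(1,2)]] .
  have \<gamma>F: "\<gamma> (?F v) = v" for v
    using F\<gamma>[of "?F v"] assms(3) inj by simp
  have F: "(?F has_real_derivative c * deriv f v) (at v)" for v
    by (auto intro!: derivative_eq_intros admissible_deriv[OF assms(1)])
  have "isCont \<gamma> (?F x)"
    by (rule isCont_inverse_function[OF zero_less_one \<gamma>F DERIV_isCont[OF F]])
  then have cont: "isCont \<gamma> 0" by simp
  show 0: "\<gamma> 0 = x" using \<gamma>[of 0] assms(3) inj by simp
  have "0 < 1 / k" "1 / k \<le> deriv f x"
    using assms unfolding admissible_fun_def by auto
  then have "0 < deriv f x" by linarith
  then show "(\<gamma> has_real_derivative inverse (c * deriv f x)) (at 0)"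
    using F[of x] assms(3) F\<gamma> cont 0
    \<comment> \<open>The end points -1 and 1 only mark out some interval around 0.\<close>
    by (intro DERIV_inverse_function[where f = ?F and a = "-1" and b = 1]) auto
qed

context pair_graph
begin

lemma sum_parcs_swap:
  assumes "C \<subseteq> parcs G"
  shows "(\<Sum>(i, j)\<in>parcs G. if (j, i) \<in> C then f j i else (0::real)) = (\<Sum>(i, j)\<in>C. f i j)"
proof -
  have "(\<Sum>(i, j)\<in>parcs G. if (j, i) \<in> C then f j i else 0)
      = (\<Sum>(i, j)\<in>C\<inverse>. f j i)"
    using assms pair_finite_arcs pair_sym_arcs
    by (intro sum.mono_neutral_cong_right) (auto dest: arcs_symmetric split: if_splits)
  also have "\<dots> = (\<Sum>(i, j)\<in>C. f i j)"
    by (rule sum.reindex_bij_witness[of _ prod.swap prod.swap]) auto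
  finally show ?thesis .
qed

text \<open>By the chain rule the factor w h'(g) of the energy derivative cancels against that of
  the shift, leaving g on each arc of C. The reversed arcs contribute the same again, which absorbs
  the factor 1/2 in \<open>energy\<close>.\<close>

lemma DERIV_energy_cycle_update:
  assumes "edge_weights G w" "edge_funs G k h" "1 \<le> k" "edge_vector G g" "oriented_cycle G C"
  shows "((\<lambda>t. energy G w h (cycle_update G w h g C t)) has_real_derivative
           (\<Sum>(i, j)\<in>set C. g i j)) (at 0)"
proof -
  let ?u = "cycle_update G w h g C"
  have shift: "is_cycle_shift G w h g C t (cycle_shift G w h g C t)" for t
    unfolding cycle_shift_def
    by (rule theI'[OF ex1_cycle_shift[OF assms(1,2,3,5)]])
  have sub: "set C \<subseteq> parcs G"
    using assms(5) unfolding oriented_cycle_def cycle_def awalk_def by auto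
  have arc: "w i j = w j i" "0 < w i j" "h i j = h j i" "admissible_fun k (h i j)"
      "g j i = - g i j" if "(i, j) \<in> parcs G" for i j
    using that assms unfolding edge_weights_def edge_funs_def edge_vector_def by blast+
  have anti: "?u t j i = - ?u t i j" if "(i, j) \<in> parcs G" for i j t
    using that shift[of t] arc(5)[OF that]
    unfolding is_cycle_shift_def edge_vector_def cycle_update_def by auto
  have on: "((\<lambda>t. edge_energy w h i j (?u t i j)) has_real_derivative g i j) (at 0)"
    if C: "(i, j) \<in> set C" for i j
  proof -
    have ij: "(i, j) \<in> parcs G" using C sub by blast
    have "w i j * h i j (?u t i j) = w i j * h i j (g i j) + t" for t
      using shift[of t] C unfolding is_cycle_shift_def cycle_update_def by blast
    note \<gamma> = admissible_shift[OF arc(4)[OF ij] assms(3) arc(2)[OF ij] this]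
    have "0 < 1 / k" "1 / k \<le> deriv (h i j) (g i j)"
      using assms(3) arc(4)[OF ij] unfolding admissible_fun_def by auto
    then have "deriv (h i j) (g i j) \<noteq> 0" by linarith
    then have "w i j * (g i j * deriv (h i j) (g i j)) * inverse (w i j * deriv (h i j) (g i j)) = g i j"
      using arc(2)[OF ij] by (simp add: field_simps)
    with DERIV_chain2[OF DERIV_edge_energy[where h = h and w = w, OF arc(4)[OF ij]] \<gamma>(2)] show ?thesis
      by (simp only: \<gamma>(1))
  qed
  \<comment> \<open>Evenness of the edge energy carries the derivative from an arc of C over to its
    reverse.\<close>
  have rev: "edge_energy w h i j (?u t i j) = edge_energy w h j i (?u t j i)"
    if "(i, j) \<in> parcs G" for i j t
    using edge_energy_even[where h = h and w = w, OF arc(4)[OF that]] anti[OF that] arc[OF that]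
    by (simp add: edge_energy_def)
  have off: "?u t i j = g i j" if "(i, j) \<notin> set C" "(j, i) \<notin> set C" for i j t
    using shift[of t] that unfolding is_cycle_shift_def cycle_update_def by simp
  have summand: "((\<lambda>t. edge_energy w h i j (?u t i j)) has_real_derivative
      (if (i, j) \<in> set C then g i j else 0) + (if (j, i) \<in> set C then g j i else 0)) (at 0)"
    if ij: "(i, j) \<in> parcs G" for i j
  proof -
    consider "(i, j) \<in> set C" | "(j, i) \<in> set C" | "(i, j) \<notin> set C" "(j, i) \<notin> set C" by blast
    then show ?thesis
    proof cases
      case 1
      with on[OF 1] oriented_cycle_no_reverse[OF assms(5)] show ?thesis by auto
    next
      case 2
      with on[OF 2] oriented_cycle_no_reverse[OF assms(5)] show ?thesis
        by (auto simp: rev[OF ij])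
    next
      case 3
      then show ?thesis by (simp add: off)
    qed
  qed
  have "((\<lambda>t. energy G w h (?u t)) has_real_derivative
      (1 / 2) * (\<Sum>(i, j)\<in>parcs G.
        (if (i, j) \<in> set C then g i j else 0) + (if (j, i) \<in> set C then g j i else 0))) (at 0)"
    unfolding energy_def
    by (intro DERIV_cmult DERIV_sum) (auto intro: summand)
  moreover have "(\<Sum>(i, j)\<in>parcs G. if (i, j) \<in> set C then g i j else 0) = (\<Sum>(i, j)\<in>set C. g i j)"
    using sub pair_finite_arcs by (intro sum.mono_neutral_cong_right) auto
  ultimately show ?thesis
    using sum_parcs_swap[OF sub, of g] by (simp add: case_prod_unfold sum.distrib)
qed

text \<open>Strong induction on length: a repeated vertex splits the walk into two shorter closed
  walks. Otherwise it is a cycle, either an oriented one or an arc traversed back and forth, where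
  antisymmetry applies.\<close>

lemma closed_walk_sum_zero:
  fixes g :: "'a \<Rightarrow> 'a \<Rightarrow> real"
  assumes anti: "edge_vector G g"
    and cyc: "\<And>C. oriented_cycle G C \<Longrightarrow> (\<Sum>(i, j)\<in>set C. g i j) = 0"
    and walk: "awalk u p u"
  shows "(\<Sum>(i, j)\<leftarrow>p. g i j) = 0"
  using walk
proof (induction "length p" arbitrary: u p rule: less_induct)
  case less
  show ?case
  proof (cases p)
    case (Cons e es)
    then have es: "awalk (snd e) es u" and e: "e \<in> parcs G" "fst e = u"
      using less.prems by (auto simp: awalk_Cons_iff)
    show ?thesis
    \<comment> \<open>Dropping the first arc discards the first occurrence of u, which would
      otherwise always be a repetition.\<close>
    proof (cases "distinct (awalk_verts (snd e) es)")
      case True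
      then have c: "cycle p"
        using less.prems Cons unfolding cycle_def by auto
      show ?thesis
      proof (cases "3 \<le> length p")
        case True
        with c have "oriented_cycle G p" by (simp add: oriented_cycle_def)
        from cyc[OF this] show ?thesis
          using c unfolding cycle_conv by (auto simp: sum_list_distinct_conv_sum_set)
      next
        case False
        have "2 \<le> length p" using c unfolding cycle_digraph_conv by blast
        with False have "length p = 2" by simp
        then obtain d where "p = [e, d]" using Cons by (cases es) auto
        with less.prems have "d = (snd e, fst e)"
          by (cases d) (auto simp: awalk_Cons_iff awalk_Nil_iff)
        with \<open>p = [e, d]\<close> e anti show ?thesis
          by (cases e) (auto simp: edge_vector_def)
      qed
    next
      case False
      obtain q r s v where es_eq: "es = q @ r @ s" and "r \<noteq> []"
        and "awalk (snd e) q v" "awalk v r v" "awalk v s u"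
        using awalk_not_distinct_decomp[OF es False] by auto
      \<comment> \<open>Excising r leaves a closed walk, shorter than p because r is nonempty; r
        itself is shorter because it omits e.\<close>
      moreover have "awalk u (e # q @ s) u"
        using calculation e by (auto simp: awalk_Cons_iff)
      ultimately have "(\<Sum>(i, j)\<leftarrow>r. g i j) = 0" "(\<Sum>(i, j)\<leftarrow>e # q @ s. g i j) = 0"
        using Cons by (auto intro!: less.hyps simp del: list.map sum_list.Cons)
      then show ?thesis by (simp add: Cons es_eq)
    qed
  qed simp
qed

text \<open>Path independence: the sum along a walk from i to the root r does not depend on the
  walk, so any choice gives the potential.\<close>

lemma p_feasible_if_closed_walks:
  fixes g :: "'a \<Rightarrow> 'a \<Rightarrow> real"
  assumes conn: "connected G"
    and closed: "\<And>u p. awalk u p u \<Longrightarrow> (\<Sum>(i, j)\<leftarrow>p. g i j) = 0"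
  shows "p_feasible G g"
proof -
  have sc: "strongly_connected G"
    using conn sym_arcs by (intro symmetric_connected_imp_strongly_connected)
  then obtain r where r: "r \<in> pverts G"
    unfolding strongly_connected_def by auto
  have walk: "\<exists>p. awalk u p v" if "u \<in> pverts G" "v \<in> pverts G" for u v
    using sc that unfolding strongly_connected_def by (auto simp: reachable_awalk)
  define P where "P i = (SOME p. awalk i p r)" for i
  have P: "awalk i (P i) r" if "i \<in> pverts G" for i
    unfolding P_def using walk[OF that r] by (rule someI_ex)
  define x where "x i = (\<Sum>(i, j)\<leftarrow>P i. g i j)" for i
  have "g i j = x i - x j" if ij: "(i, j) \<in> parcs G" for i j
  proof -
    have verts: "i \<in> pverts G" "j \<in> pverts G"
      using ij by (auto dest: arc_fst_in_verts arc_snd_in_verts)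
    then obtain q where q: "awalk r q i" using walk[OF r] by blast
    \<comment> \<open>Both closed walks share q, so comparing their zero sums gives x i = g i j + x
      j.\<close>
    have "awalk r (q @ P i) r" "awalk r (q @ (i, j) # P j) r"
      using q P verts ij by (auto simp: awalk_Cons_iff)
    from this[THEN closed] show ?thesis by (simp add: x_def)
  qed
  then show ?thesis unfolding p_feasible_def by blast
qed

end

theorem theorem4p2:
  fixes G :: "'v pair_pre_digraph"
    and w :: "'v \<Rightarrow> 'v \<Rightarrow> real"
    and h :: "'v \<Rightarrow> 'v \<Rightarrow> real \<Rightarrow> real"
    and k :: real
    and b :: "'v \<Rightarrow> real"
    and g :: "'v \<Rightarrow> 'v \<Rightarrow> real"
  assumes "pair_graph G"
    and "Digraph_Component.connected (with_proj G)"
    and "edge_weights G w"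
    and "1 \<le> k"
    and "edge_funs G k h"
    and "(\<Sum>i \<in> pverts G. b i) = 0"
    and "edge_vector G g"
    and "b_feasible G w h b g"
    and "\<And>C t. oriented_cycle G C \<Longrightarrow> energy G w h g \<le> energy G w h (cycle_update G w h g C t)"
  shows "p_feasible G g"
proof -
  interpret pair_graph G by fact
  have "(\<Sum>(i, j)\<in>set C. g i j) = 0" if C: "oriented_cycle G C" for C
  proof -
    let ?\<Phi> = "\<lambda>t. energy G w h (cycle_update G w h g C t)"
    \<comment> \<open>By uniqueness of the shift, the update at t = 0 is g itself, so minimality of
      g places a minimum of \<open>?\<Phi>\<close> at 0.\<close>
    have "is_cycle_shift G w h g C 0 (\<lambda>i j. 0)"
      by (auto simp: is_cycle_shift_def edge_vector_def)
    then have "cycle_shift G w h g C 0 = (\<lambda>i j. 0)"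
      unfolding cycle_shift_def
      by (rule the1_equality[OF ex1_cycle_shift[OF assms(3,5,4) C]])
    then have "?\<Phi> 0 \<le> ?\<Phi> t" for t
      using assms(9)[OF C, of t] by (simp add: cycle_update_def)
    then show ?thesis
      using DERIV_local_min[OF DERIV_energy_cycle_update[OF assms(3,5,4,7) C] zero_less_one] by blast
  qed
  then show ?thesis
    using assms(2,7) closed_walk_sum_zero p_feasible_if_closed_walks by blast
qed

end
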